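(* Let $R$ be a Noetherian ring and let $I_1,\ldots,I_s\subseteq R$ be ideals of positive grade. For each $i=1,\ldots,s$, let $\{f_{ij}\mid j=1,\ldots,n_i\}$ be a generating set of $I_i$ which contains at least one nonzerodivisor $f_{ij_i}$ of $R$ (for some $j_i\in\{1,\ldots,n_i\}$). Let $\underline{Y}=\{Y_{ij}\mid i=1,\ldots,s,\ j=1,\ldots,n_i\}$ be indeterminates over $R$, set $h=\prod_{i=1}^s f_{ij_i}$, and set \[ \Gamma=\langle Y_{ij}f_{ij'}-Y_{ij'}f_{ij}\mid i=1,\ldots,s \text{ and } j,j'\in\{1,\ldots,n_i\}\rangle : h^\infty\ \subseteq R[\underline{Y}]. \] Then $\Gamma$ is the defining ideal of the multi-Rees algebra $\mathcal{R}(I_1,\ldots,I_s)$, i.e. $\Gamma=\ker(\varphi)$, where $\varphi: R[\underline{Y}]\to \mathcal{R}(I_1,\ldots,I_s)\subseteq R[T_1,\ldots,T_s]$ is the $R$-algebra homomorphism with $\varphi(Y_{ij})=f_{ij}T_i$ for all $i=1,\ldots,s$ and $j=1,\ldots,n_i$.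
   Context: Rings are commutative with identity. For an ideal $J$ of a Noetherian ring $R$, $\operatorname{grade}(J)$ denotes the common length of the maximal $R$-sequences in $J$. For ideals $I_1,\ldots,I_s$ of $R$ and indeterminates $T_1,\ldots,T_s$ over $R$, the multi-Rees algebra is the $R$-subalgebra \[\mathcal{R}(I_1,\ldots,I_s)=R[I_1T_1,\ldots,I_sT_s]=\bigoplus_{a_1,\ldots,a_s\ge 0} I_1^{a_1}\cdots I_s^{a_s}\,T_1^{a_1}\cdots T_s^{a_s}\subseteq R[T_1,\ldots,T_s].\] Given generating sets $I_i=\langle f_{ij}\mid j=1,\ldots,n_i\rangle$, the defining ideal of $\mathcal{R}(I_1,\ldots,I_s)$ (with respect to these generators) is the kernel of the surjective $R$-algebra homomorphism $\varphi:R[\underline{Y}]\to\mathcal{R}(I_1,\ldots,I_s)$, $Y_{ij}\mapsto f_{ij}T_i$. For an ideal $L$ of a ring $S$ and $h\in S$, $L:h^\infty=\{g\in S\mid h^m g\in L \text{ for some } m\ge 0\}$. *)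

theory Defs
  imports "HOL-Algebra.Algebra" "HOL-Library.Extended_Nat"
begin

section \<open>Polynomial rings in a set of indeterminates\<close>

text \<open>
  The theory \<open>HOL-Algebra.Indexed_Polynomials\<close> provides the elements of
  \<open>R[X\<^sub>v | v \<in> V]\<close> (coefficient functions on monomials, a monomial being a multiset of
  indeterminates), their addition, the constants and the indeterminates, but it does not turn
  them into a ring. The product below is the usual convolution: the coefficient of \<open>P Q\<close> at
  \<open>m\<close> sums over the finitely many divisors \<open>a\<close> of the monomial \<open>m\<close>.
\<close>

definition mpoly_ring :: "('a, 'r) ring_scheme \<Rightarrow> 'v set \<Rightarrow> ('v multiset \<Rightarrow> 'a) ring" where
  "mpoly_ring R V =
    \<lparr> carrier = ring.indexed_pset R V (carrier R),
      monoid.mult = (\<lambda>P Q m. \<Oplus>\<^bsub>R\<^esub>a\<in>{a. a \<subseteq># m}. P a \<otimes>\<^bsub>R\<^esub> Q (m - a)),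
      monoid.one = ring.indexed_const R \<one>\<^bsub>R\<^esub>,
      ring.zero = ring.indexed_const R \<zero>\<^bsub>R\<^esub>,
      ring.add = ring.indexed_padd R \<rparr>"

abbreviation mpoly_const :: "('a, 'r) ring_scheme \<Rightarrow> 'a \<Rightarrow> 'v multiset \<Rightarrow> 'a" where
  "mpoly_const R \<equiv> ring.indexed_const R"

abbreviation mpoly_var :: "('a, 'r) ring_scheme \<Rightarrow> 'v \<Rightarrow> 'v multiset \<Rightarrow> 'a" where
  "mpoly_var R \<equiv> ring.indexed_var R"


section \<open>Nonzerodivisors, regular sequences and grade\<close>

definition nonzerodivisor :: "('a, 'r) ring_scheme \<Rightarrow> 'a \<Rightarrow> bool" where
  "nonzerodivisor R x \<longleftrightarrow>
    x \<in> carrier R \<and> (\<forall>a\<in>carrier R. x \<otimes>\<^bsub>R\<^esub> a = \<zero>\<^bsub>R\<^esub> \<longrightarrow> a = \<zero>\<^bsub>R\<^esub>)"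

text \<open>
  \<open>x\<^sub>1, \<dots>, x\<^sub>k\<close> is an \<open>R\<close>-sequence if each \<open>x\<^sub>i\<close> is a nonzerodivisor on
  \<open>R / (x\<^sub>1, \<dots>, x\<^sub>i\<^sub>-\<^sub>1)\<close> and \<open>(x\<^sub>1, \<dots>, x\<^sub>k) \<noteq> R\<close>.
\<close>

definition R_sequence :: "('a, 'r) ring_scheme \<Rightarrow> 'a list \<Rightarrow> bool" where
  "R_sequence R xs \<longleftrightarrow>
    set xs \<subseteq> carrier R \<and>
    (\<forall>k<length xs. \<forall>a\<in>carrier R.
       xs ! k \<otimes>\<^bsub>R\<^esub> a \<in> Idl\<^bsub>R\<^esub> (set (take k xs)) \<longrightarrow> a \<in> Idl\<^bsub>R\<^esub> (set (take k xs))) \<and>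
    Idl\<^bsub>R\<^esub> (set xs) \<noteq> carrier R"

definition maximal_R_sequence_in :: "('a, 'r) ring_scheme \<Rightarrow> 'a set \<Rightarrow> 'a list \<Rightarrow> bool" where
  "maximal_R_sequence_in R J xs \<longleftrightarrow>
    R_sequence R xs \<and> set xs \<subseteq> J \<and> (\<forall>x\<in>J. \<not> R_sequence R (xs @ [x]))"

text \<open>
  In a Noetherian ring the maximal \<open>R\<close>-sequences in a proper ideal all have the same finite
  length (Rees). For the unit ideal this fails in general, and the usual convention
  \<open>grade(R) = \<infinity>\<close> is used.
\<close>

definition grade :: "('a, 'r) ring_scheme \<Rightarrow> 'a set \<Rightarrow> enat" where
  "grade R J =
    (if J = carrier R then \<infinity>
     else enat (THE n. \<forall>xs. maximal_R_sequence_in R J xs \<longrightarrow> length xs = n))"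


section \<open>Saturation and multi-Rees algebras\<close>

definition saturation :: "('a, 'r) ring_scheme \<Rightarrow> 'a set \<Rightarrow> 'a \<Rightarrow> 'a set" where
  "saturation S L h = {g \<in> carrier S. \<exists>m::nat. h [^]\<^bsub>S\<^esub> m \<otimes>\<^bsub>S\<^esub> g \<in> L}"

text \<open>
  \<open>R[I\<^sub>1T\<^sub>1, \<dots>, I\<^sub>sT\<^sub>s]\<close>: the subring of \<open>R[T\<^sub>1, \<dots>, T\<^sub>s]\<close> generated by the constants and all
  \<open>a T\<^sub>i\<close> with \<open>a \<in> I\<^sub>i\<close>.
\<close>

definition multi_Rees ::
  "('a, 'r) ring_scheme \<Rightarrow> nat \<Rightarrow> (nat \<Rightarrow> 'a set) \<Rightarrow> (nat multiset \<Rightarrow> 'a) ring" where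
  "multi_Rees R s I =
    (let RT = mpoly_ring R {1..s} in
     RT \<lparr> carrier := generate_ring RT
       (mpoly_const R ` carrier R \<union>
        {mpoly_const R a \<otimes>\<^bsub>RT\<^esub> mpoly_var R i | i a. i \<in> {1..s} \<and> a \<in> I i}) \<rparr>)"

text \<open>The indeterminate \<open>Y\<^sub>i\<^sub>j\<close> is indexed by the pair \<open>(i, j)\<close>.\<close>

definition Y_indices :: "nat \<Rightarrow> (nat \<Rightarrow> nat) \<Rightarrow> (nat \<times> nat) set" where
  "Y_indices s n = (SIGMA i:{1..s}. {1..n i})"

text \<open>
  The \<open>R\<close>-algebra homomorphisms \<open>R[Y] \<rightarrow> R[I\<^sub>1T\<^sub>1, \<dots>, I\<^sub>sT\<^sub>s]\<close> with \<open>Y\<^sub>i\<^sub>j \<mapsto> f\<^sub>i\<^sub>j T\<^sub>i\<close>. As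
  functions they are determined only on the carrier of \<open>R[Y]\<close>.
\<close>

definition is_Rees_presentation ::
  "('a, 'r) ring_scheme \<Rightarrow> nat \<Rightarrow> (nat \<Rightarrow> nat) \<Rightarrow> (nat \<Rightarrow> 'a set) \<Rightarrow> (nat \<Rightarrow> nat \<Rightarrow> 'a) \<Rightarrow>
   (((nat \<times> nat) multiset \<Rightarrow> 'a) \<Rightarrow> (nat multiset \<Rightarrow> 'a)) \<Rightarrow> bool" where
  "is_Rees_presentation R s n I f \<phi> \<longleftrightarrow>
    \<phi> \<in> ring_hom (mpoly_ring R (Y_indices s n)) (multi_Rees R s I) \<and>
    (\<forall>c\<in>carrier R. \<phi> (mpoly_const R c) = mpoly_const R c) \<and>
    (\<forall>i\<in>{1..s}. \<forall>j\<in>{1..n i}.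
       \<phi> (mpoly_var R (i, j)) =
         mpoly_const R (f i j) \<otimes>\<^bsub>mpoly_ring R {1..s}\<^esub> mpoly_var R i)"

end

theory Submission
  imports Defs
begin

text \<open>
  Write \<open>h\<^sub>i = f\<^sub>i\<^sub>,\<^sub>j\<^sub>i\<close>, let \<open>L\<close> be the ideal of the binomial relations and let \<open>\<phi>\<close> be the
  presentation. Since \<open>\<phi>\<close> kills \<open>L\<close> and \<open>h\<close> is a nonzerodivisor on \<open>R[T]\<close>, the kernel contains
  \<open>L : h\<^sup>\<infinity>\<close>. Conversely, \<open>h\<^sub>i Y\<^sub>i\<^sub>j \<equiv> f\<^sub>i\<^sub>j Y\<^sub>i\<^sub>,\<^sub>j\<^sub>i\<close> modulo \<open>L\<close>, so for every \<open>P\<close> some \<open>h\<^sup>k P\<close> is congruent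
  modulo \<open>L\<close> to a polynomial \<open>Q\<close> in the variables \<open>Y\<^sub>i\<^sub>,\<^sub>j\<^sub>i\<close> alone. On such polynomials \<open>\<phi>\<close> merely
  multiplies each coefficient by a product of the nonzerodivisors \<open>h\<^sub>i\<close> and renames the variables,
  so it is injective there: \<open>\<phi>(P) = 0\<close> gives \<open>Q = 0\<close> and hence \<open>h\<^sup>k P \<in> L\<close>.
\<close>

section \<open>The ring of polynomials in a set of indeterminates\<close>

context ring
begin

lemma mpoly_carrier [simp]: "carrier (mpoly_ring R V) = indexed_pset V (carrier R)"
  by (simp add: mpoly_ring_def)

lemma mpoly_zero: "\<zero>\<^bsub>mpoly_ring R V\<^esub> = (\<lambda>m. \<zero>)"
  by (simp add: mpoly_ring_def indexed_zero_def)

lemma mpoly_one: "\<one>\<^bsub>mpoly_ring R V\<^esub> = indexed_const \<one>"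
  by (simp add: mpoly_ring_def)

lemma mpoly_add: "P \<oplus>\<^bsub>mpoly_ring R V\<^esub> Q = indexed_padd P Q"
  by (simp add: mpoly_ring_def)

lemma mpoly_mult_apply:
  "(P \<otimes>\<^bsub>mpoly_ring R V\<^esub> Q) m = (\<Oplus>a\<in>{a. a \<subseteq># m}. P a \<otimes> Q (m - a))"
  by (simp add: mpoly_ring_def)

lemma indexed_pset_coeff [simp]: "P \<in> indexed_pset V (carrier R) \<Longrightarrow> P m \<in> carrier R"
  using carrier_coeffE indexed_pset_in_carrier by blast

text \<open>A submultiset of \<open>m\<close> has its elements in the finite set
  \<open>set_mset m\<close> and size at most \<open>size m\<close>. Finiteness matters because
  \<open>finsum\<close> over an infinite set is zero by default.\<close>

lemma finite_submultisets: "finite {a. a \<subseteq># (m :: 'v multiset)}"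
proof (rule finite_subset)
  show "{a. a \<subseteq># m} \<subseteq> (\<Union>k\<le>size m. multisets_of_size (set_mset m) k)"
    by (auto simp: multisets_of_size_def dest: set_mset_mono size_mset_mono mset_subset_eqD)
qed auto

text \<open>The constructors of \<open>indexed_pset V\<close> multiply only by indeterminates from
  \<open>V\<close>, so a monomial involving any other one never acquires a coefficient.\<close>

lemma indexed_pset_support:
  assumes "P \<in> indexed_pset V (carrier R)" "\<not> set_mset m \<subseteq> V"
  shows "P m = \<zero>"
  using assms
proof (induction arbitrary: m)
  case (indexed_const k)
  then show ?case by (auto simp: indexed_const_def)
next
  case (indexed_padd P Q)
  then show ?case by (simp add: indexed_padd_def)
next
  case (indexed_pmult P i)
  have "\<not> set_mset (m - {#i#}) \<subseteq> V" if "i \<in># m"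
  proof
    assume "set_mset (m - {#i#}) \<subseteq> V"
    then have "set_mset (add_mset i (m - {#i#})) \<subseteq> V"
      using indexed_pmult.hyps(2) by simp
    then show False using indexed_pmult.prems that by simp
  qed
  then show ?case using indexed_pmult by (simp add: indexed_pmult_def)
qed

text \<open>With the next two lemmas this gives a recursion for the product in its left factor, one
  equation per constructor of \<open>indexed_pset\<close>. Closure, associativity and the
  multiplicativity of substitutions then follow by induction, without rearranging double
  sums.\<close>

lemma mpoly_mult_const:
  assumes "k \<in> carrier R" "Q \<in> indexed_pset V (carrier R)"
  shows "indexed_const k \<otimes>\<^bsub>mpoly_ring R V\<^esub> Q = (\<lambda>m. k \<otimes> Q m)"
proof
  fix m
  have "(indexed_const k \<otimes>\<^bsub>mpoly_ring R V\<^esub> Q) m =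
      (\<Oplus>a\<in>{a. a \<subseteq># m}. if {#} = a then k \<otimes> Q (m - a) else \<zero>)"
    unfolding mpoly_mult_apply using assms
    by (intro finsum_cong') (auto simp: indexed_const_def)
  also have "\<dots> = k \<otimes> Q m"
    using assms finsum_singleton[of "{#}" "{a. a \<subseteq># m}" "\<lambda>a. k \<otimes> Q (m - a)"]
    by (simp add: finite_submultisets Pi_def)
  finally show "(indexed_const k \<otimes>\<^bsub>mpoly_ring R V\<^esub> Q) m = k \<otimes> Q m" .
qed

lemma mpoly_mult_padd:
  assumes "P \<in> indexed_pset V (carrier R)" "P' \<in> indexed_pset V (carrier R)"
    "Q \<in> indexed_pset V (carrier R)"
  shows "indexed_padd P P' \<otimes>\<^bsub>mpoly_ring R V\<^esub> Q =
    indexed_padd (P \<otimes>\<^bsub>mpoly_ring R V\<^esub> Q) (P' \<otimes>\<^bsub>mpoly_ring R V\<^esub> Q)"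
  using assms
  by (auto simp: fun_eq_iff mpoly_mult_apply indexed_padd_def l_distr Pi_def
      simp flip: finsum_addf)

lemma mpoly_mult_pmult:
  assumes "P \<in> indexed_pset V (carrier R)" "Q \<in> indexed_pset V (carrier R)"
  shows "indexed_pmult P i \<otimes>\<^bsub>mpoly_ring R V\<^esub> Q = indexed_pmult (P \<otimes>\<^bsub>mpoly_ring R V\<^esub> Q) i"
proof
  fix m
  define g where "g a = indexed_pmult P i a \<otimes> Q (m - a)" for a
  have g: "g a \<in> carrier R" for a
    using assms by (simp add: g_def indexed_pmult_def)
  show "(indexed_pmult P i \<otimes>\<^bsub>mpoly_ring R V\<^esub> Q) m = indexed_pmult (P \<otimes>\<^bsub>mpoly_ring R V\<^esub> Q) i m"
  proof (cases "i \<in># m")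
    case True
    then obtain m' where m: "m = add_mset i m'"
      by (meson multi_member_split)
    \<comment> \<open>Divisors of \<open>m\<close> without \<open>i\<close> contribute zero. The
      remaining ones are exactly \<open>add_mset i a\<close> with \<open>a\<close> a divisor of
      \<open>m'\<close>, so the sum can be reindexed over the divisors of \<open>m'\<close>.\<close>
    have "(\<Oplus>a\<in>{a. a \<subseteq># m}. g a) = (\<Oplus>a\<in>add_mset i ` {a. a \<subseteq># m'}. g a)"
    proof (rule add.finprod_mono_neutral_cong_left[symmetric])
      show "g a = \<zero>" if "a \<in> {a. a \<subseteq># m} - add_mset i ` {a. a \<subseteq># m'}" for a
      proof -
        have "i \<notin># a"
          using that by (auto simp: m dest!: multi_member_split)
        then show ?thesis using assms by (simp add: g_def indexed_pmult_def)
      qed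
    qed (auto simp: m g finite_submultisets)
    also have "\<dots> = (\<Oplus>a\<in>{a. a \<subseteq># m'}. g (add_mset i a))"
      by (rule finsum_reindex) (auto simp: g inj_on_def)
    finally show ?thesis
      by (simp add: mpoly_mult_apply indexed_pmult_def m g_def)
  next
    case False
    have "g a = \<zero>" if "a \<subseteq># m" for a
      using that False assms mset_subset_eqD[OF that, of i] by (auto simp: g_def indexed_pmult_def)
    then have "(\<Oplus>a\<in>{a. a \<subseteq># m}. g a) = \<zero>"
      by (intro add.finprod_one_eqI) auto
    then show ?thesis
      using False by (simp add: mpoly_mult_apply indexed_pmult_def g_def)
  qed
qed

lemma indexed_pset_smult:
  fixes V :: "'v set"
  assumes "k \<in> carrier R" "Q \<in> indexed_pset V (carrier R)"
  shows "(\<lambda>m. k \<otimes> Q m) \<in> indexed_pset V (carrier R)"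
  using assms(2)
proof induction
  case (indexed_const c)
  then have "(\<lambda>m. k \<otimes> indexed_const c m) = (indexed_const (k \<otimes> c) :: 'v multiset \<Rightarrow> 'a)"
    using assms(1) by (auto simp: indexed_const_def)
  moreover have "indexed_const (k \<otimes> c) \<in> indexed_pset V (carrier R)"
    using assms(1) indexed_const by (intro indexed_pset.indexed_const) simp
  ultimately show ?case by simp
next
  case (indexed_padd P Q)
  then have "(\<lambda>m. k \<otimes> indexed_padd P Q m) = indexed_padd (\<lambda>m. k \<otimes> P m) (\<lambda>m. k \<otimes> Q m)"
    using assms(1) by (auto simp: indexed_padd_def r_distr)
  then show ?case
    using indexed_padd by (simp add: indexed_pset.indexed_padd)
next
  case (indexed_pmult P i)
  then have "(\<lambda>m. k \<otimes> indexed_pmult P i m) = indexed_pmult (\<lambda>m. k \<otimes> P m) i"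
    using assms(1) by (auto simp: indexed_pmult_def)
  then show ?case
    using indexed_pmult by (simp add: indexed_pset.indexed_pmult)
qed

lemma mpoly_mult_closed:
  assumes "P \<in> indexed_pset V (carrier R)" "Q \<in> indexed_pset V (carrier R)"
  shows "P \<otimes>\<^bsub>mpoly_ring R V\<^esub> Q \<in> indexed_pset V (carrier R)"
  using assms
proof induction
  case (indexed_const k)
  then show ?case by (simp add: mpoly_mult_const indexed_pset_smult)
next
  case (indexed_padd P P')
  then show ?case by (simp add: mpoly_mult_padd indexed_pset.indexed_padd)
next
  case (indexed_pmult P i)
  then show ?case by (simp add: mpoly_mult_pmult indexed_pset.indexed_pmult)
qed

lemma mpoly_mult_assoc:
  assumes "P \<in> indexed_pset V (carrier R)" "Q \<in> indexed_pset V (carrier R)"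
    "T \<in> indexed_pset V (carrier R)"
  shows "(P \<otimes>\<^bsub>mpoly_ring R V\<^esub> Q) \<otimes>\<^bsub>mpoly_ring R V\<^esub> T =
    P \<otimes>\<^bsub>mpoly_ring R V\<^esub> (Q \<otimes>\<^bsub>mpoly_ring R V\<^esub> T)"
  using assms
proof induction
  case (indexed_const k)
  then have "((\<lambda>m. k \<otimes> Q m) \<otimes>\<^bsub>mpoly_ring R V\<^esub> T) m = k \<otimes> (Q \<otimes>\<^bsub>mpoly_ring R V\<^esub> T) m" for m
    by (auto simp: mpoly_mult_apply finsum_rdistr finite_submultisets m_assoc Pi_def
        intro!: finsum_cong')
  then show ?case
    using indexed_const by (simp add: mpoly_mult_const mpoly_mult_closed fun_eq_iff)
next
  case (indexed_padd P P')
  then show ?case by (simp add: mpoly_mult_padd mpoly_mult_closed)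
next
  case (indexed_pmult P i)
  then show ?case by (simp add: mpoly_mult_pmult mpoly_mult_closed)
qed

end

context cring
begin

text \<open>The map sending \<open>a\<close> to \<open>m - a\<close> is an involution on the
  divisors of \<open>m\<close>; reindexing the convolution sum by it exchanges the two
  factors.\<close>

lemma mpoly_mult_comm:
  fixes V :: "'v set"
  assumes "P \<in> indexed_pset V (carrier R)" "Q \<in> indexed_pset V (carrier R)"
  shows "P \<otimes>\<^bsub>mpoly_ring R V\<^esub> Q = Q \<otimes>\<^bsub>mpoly_ring R V\<^esub> P"
proof
  fix m :: "'v multiset"
  have double_diff_mset: "m - (m - a) = a" if "a \<subseteq># m" for a
    using that by (metis add_diff_cancel_right' subset_mset.add_diff_inverse)
  have img: "(-) m ` {a. a \<subseteq># m} = {a. a \<subseteq># m}"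
  proof
    show "{a. a \<subseteq># m} \<subseteq> (-) m ` {a. a \<subseteq># m}"
    proof
      fix a assume "a \<in> {a. a \<subseteq># m}"
      then have "a = m - (m - a)" by (simp add: double_diff_mset)
      then show "a \<in> (-) m ` {a. a \<subseteq># m}"
        by (metis diff_subset_eq_self imageI mem_Collect_eq)
    qed
  qed auto
  have inj: "inj_on ((-) m) {a. a \<subseteq># m}"
    by (rule inj_on_inverseI[where g = "(-) m"]) (simp add: double_diff_mset)
  have "(\<Oplus>a\<in>{a. a \<subseteq># m}. P a \<otimes> Q (m - a)) = (\<Oplus>a\<in>(-) m ` {a. a \<subseteq># m}. P a \<otimes> Q (m - a))"
    by (simp only: img)
  also have "\<dots> = (\<Oplus>a\<in>{a. a \<subseteq># m}. P (m - a) \<otimes> Q (m - (m - a)))"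
    using inj assms by (intro finsum_reindex) auto
  also have "\<dots> = (\<Oplus>a\<in>{a. a \<subseteq># m}. Q a \<otimes> P (m - a))"
    using assms by (intro finsum_cong') (auto simp: m_comm double_diff_mset)
  finally show "(P \<otimes>\<^bsub>mpoly_ring R V\<^esub> Q) m = (Q \<otimes>\<^bsub>mpoly_ring R V\<^esub> P) m"
    by (simp add: mpoly_mult_apply)
qed

lemma mpoly_cring: "cring (mpoly_ring R V)"
proof (rule cringI)
  \<comment> \<open>The additive inverse is taken to be the scalar multiple by minus one, since
    \<open>indexed_pset_smult\<close> already places it in the carrier.\<close>
  have "indexed_padd (\<lambda>m. (\<ominus> \<one>) \<otimes> P m) P = (\<lambda>m. \<zero>)" if "P \<in> indexed_pset V (carrier R)" for P
    using that by (auto simp: indexed_padd_def l_minus l_neg)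
  then show "abelian_group (mpoly_ring R V)"
    by (intro abelian_groupI)
      (auto simp: mpoly_add mpoly_zero indexed_padd_def a_ac fun_eq_iff
        intro!: indexed_pset.indexed_padd[unfolded indexed_padd_def] indexed_pset_smult
        intro: indexed_pset.indexed_const[of \<zero> "carrier R" V, unfolded indexed_zero_def]
        bexI[OF _ indexed_pset_smult[of "\<ominus> \<one>"]])
  show "comm_monoid (mpoly_ring R V)"
    by (rule comm_monoidI)
      (auto simp: mpoly_one mpoly_mult_const indexed_pset.indexed_const mpoly_mult_closed
        mpoly_mult_assoc intro: mpoly_mult_comm)
qed (auto simp: mpoly_add mpoly_mult_padd)

text \<open>The constructor \<open>indexed_pmult\<close> is a shift of coefficients. Reading it as a
  ring product lets homomorphisms be evaluated in inductions over
  \<open>indexed_pset\<close>.\<close>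

lemma mpoly_pmult_eq:
  assumes "P \<in> indexed_pset V (carrier R)" "i \<in> V"
  shows "indexed_pmult P i = P \<otimes>\<^bsub>mpoly_ring R V\<^esub> indexed_var i"
proof -
  interpret S: cring "mpoly_ring R V" by (rule mpoly_cring)
  have one: "indexed_const \<one> \<in> indexed_pset V (carrier R)"
    by (simp add: indexed_pset.indexed_const)
  then have "indexed_var i \<otimes>\<^bsub>mpoly_ring R V\<^esub> P = indexed_pmult (indexed_const \<one> \<otimes>\<^bsub>mpoly_ring R V\<^esub> P) i"
    using assms unfolding indexed_var_def by (intro mpoly_mult_pmult)
  moreover have "indexed_var i \<in> indexed_pset V (carrier R)"
    unfolding indexed_var_def by (intro indexed_pset.indexed_pmult one assms)
  ultimately show ?thesis
    using assms by (simp add: mpoly_mult_const mpoly_mult_comm)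
qed

section \<open>Products and powers of nonzerodivisors\<close>

lemma nonzerodivisor_one: "nonzerodivisor R \<one>"
  by (simp add: nonzerodivisor_def)

lemma nonzerodivisor_mult:
  assumes "nonzerodivisor R x" "nonzerodivisor R y"
  shows "nonzerodivisor R (x \<otimes> y)"
  unfolding nonzerodivisor_def
proof (intro conjI ballI impI)
  have xy: "x \<in> carrier R" "y \<in> carrier R"
    using assms by (simp_all add: nonzerodivisor_def)
  then show "x \<otimes> y \<in> carrier R" by simp
  fix a assume a: "a \<in> carrier R" "x \<otimes> y \<otimes> a = \<zero>"
  then have "x \<otimes> (y \<otimes> a) = \<zero>" using xy by (simp add: m_assoc)
  then have "y \<otimes> a = \<zero>" using assms(1) xy a(1) by (simp add: nonzerodivisor_def)
  then show "a = \<zero>" using assms(2) a(1) by (simp add: nonzerodivisor_def)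
qed

lemma nonzerodivisor_pow: "nonzerodivisor R x \<Longrightarrow> nonzerodivisor R (x [^] (k :: nat))"
  by (induction k) (simp_all add: nonzerodivisor_one nonzerodivisor_mult)

lemma nonzerodivisor_finprod:
  assumes "finite A" "\<And>a. a \<in> A \<Longrightarrow> nonzerodivisor R (f a)"
  shows "nonzerodivisor R (\<Otimes>a\<in>A. f a)"
  using assms
proof (induction A)
  case empty
  then show ?case by (simp add: nonzerodivisor_one)
next
  case (insert a A)
  then have "f \<in> A \<rightarrow> carrier R" "f a \<in> carrier R"
    by (auto simp: nonzerodivisor_def)
  then show ?case using insert by (simp add: nonzerodivisor_mult)
qed

end


section \<open>Monomial substitutions\<close>

context cring
begin

text \<open>The product runs over the fixed set \<open>V\<close>, with exponent zero for absent
  indeterminates. The index set is then the same for all monomials, and values multiply factor by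
  factor.\<close>

definition monomial_eval :: "'v set \<Rightarrow> ('v \<Rightarrow> 'a) \<Rightarrow> 'v multiset \<Rightarrow> 'a" where
  "monomial_eval V c m = (\<Otimes>v\<in>V. c v [^] count m v)"

lemma monomial_eval_closed:
  "c \<in> V \<rightarrow> carrier R \<Longrightarrow> monomial_eval V c m \<in> carrier R"
  by (auto simp: monomial_eval_def intro!: finprod_closed)

lemma monomial_eval_empty [simp]: "monomial_eval V c {#} = \<one>"
  by (simp add: monomial_eval_def)

lemma monomial_eval_add_mset:
  assumes "finite V" "c \<in> V \<rightarrow> carrier R" "v \<in> V"
  shows "monomial_eval V c (add_mset v m) = c v \<otimes> monomial_eval V c m"
proof -
  have "monomial_eval V c (add_mset v m) =
      (\<Otimes>w\<in>V. (if v = w then c w else \<one>) \<otimes> c w [^] count m w)"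
    unfolding monomial_eval_def using assms
    by (intro finprod_cong') (auto simp: Pi_iff m_comm)
  also have "\<dots> = (\<Otimes>w\<in>V. if v = w then c w else \<one>) \<otimes> monomial_eval V c m"
    unfolding monomial_eval_def using assms by (intro finprod_multf) auto
  finally show ?thesis
    using assms by (simp add: finprod_singleton)
qed

text \<open>Indeterminates outside \<open>m\<close> enter with exponent zero and contribute one,
  whatever their value under \<open>c\<close>.\<close>

lemma monomial_eval_nonzerodivisor:
  assumes "finite V" "\<And>v. v \<in># m \<Longrightarrow> nonzerodivisor R (c v)"
  shows "nonzerodivisor R (monomial_eval V c m)"
  unfolding monomial_eval_def
proof (rule nonzerodivisor_finprod)
  show "nonzerodivisor R (c v [^] count m v)" for v
    using assms(2)[of v] by (cases "v \<in># m")
      (simp_all add: nonzerodivisor_pow nonzerodivisor_one not_in_iff)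
qed (rule assms)

text \<open>
  The homomorphism \<open>Y\<^sub>v \<mapsto> c\<^sub>v T\<^bsub>g v\<^esub>\<close>, given coefficientwise. If \<open>V\<close> is infinite, the index set of the sum
  may be infinite, and then the sum is the junk value \<open>\<zero>\<close>.
\<close>

definition monomial_subst ::
  "'v set \<Rightarrow> ('v \<Rightarrow> 'a) \<Rightarrow> ('v \<Rightarrow> 'w) \<Rightarrow> ('v multiset \<Rightarrow> 'a) \<Rightarrow> 'w multiset \<Rightarrow> 'a" where
  "monomial_subst V c g P =
    (\<lambda>n. \<Oplus>m\<in>{m. set_mset m \<subseteq> V \<and> image_mset g m = n}. P m \<otimes> monomial_eval V c m)"

text \<open>Renaming by \<open>g\<close> preserves the degree, so every monomial in the fibre has
  size \<open>size n\<close>, and there are finitely many of these over a finite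
  \<open>V\<close>.\<close>

lemma finite_monomial_fibre:
  assumes "finite V"
  shows "finite {m. set_mset m \<subseteq> V \<and> image_mset g m = n}"
  by (rule finite_subset[OF _ finite_multisets_of_size[OF assms, of "size n"]])
    (auto simp: multisets_of_size_def)

section \<open>Homomorphism laws and injectivity of a monomial substitution\<close>

context
  fixes V :: "'v set" and W :: "'w set" and c :: "'v \<Rightarrow> 'a" and g :: "'v \<Rightarrow> 'w"
  assumes finV: "finite V" and c: "c \<in> V \<rightarrow> carrier R" and g: "g \<in> V \<rightarrow> W"
begin

lemma monomial_subst_const:
  assumes "k \<in> carrier R"
  shows "monomial_subst V c g (indexed_const k) = indexed_const k"
proof
  fix n
  show "monomial_subst V c g (indexed_const k) n = indexed_const k n"
  proof (cases "n = {#}")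
    case True
    then have "{m. set_mset m \<subseteq> V \<and> image_mset g m = n} = {{#}}"
      by auto
    then show ?thesis
      using assms True by (simp add: monomial_subst_def indexed_const_def)
  next
    case False
    then have "(\<Oplus>m\<in>{m. set_mset m \<subseteq> V \<and> image_mset g m = n}.
        indexed_const k m \<otimes> monomial_eval V c m) = \<zero>"
      by (intro add.finprod_one_eqI) (auto simp: indexed_const_def monomial_eval_closed[OF c])
    then show ?thesis
      using False by (simp add: monomial_subst_def indexed_const_def)
  qed
qed

lemma monomial_subst_padd:
  assumes "P \<in> indexed_pset V (carrier R)" "Q \<in> indexed_pset V (carrier R)"
  shows "monomial_subst V c g (indexed_padd P Q) =
    indexed_padd (monomial_subst V c g P) (monomial_subst V c g Q)"
  using assms
  by (auto simp: monomial_subst_def indexed_padd_def fun_eq_iff l_distr Pi_def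
      monomial_eval_closed[OF c] simp flip: finsum_addf)

lemma monomial_subst_pmult:
  assumes "P \<in> indexed_pset V (carrier R)" "v \<in> V"
  shows "monomial_subst V c g (indexed_pmult P v) =
    indexed_pmult (\<lambda>n. c v \<otimes> monomial_subst V c g P n) (g v)"
proof
  fix n
  define t where "t m = indexed_pmult P v m \<otimes> monomial_eval V c m" for m
  define fib where "fib n = {m. set_mset m \<subseteq> V \<and> image_mset g m = n}" for n
  have fin: "finite (fib n)" for n
    unfolding fib_def by (rule finite_monomial_fibre[OF finV])
  have t: "t m \<in> carrier R" for m
    using assms by (simp add: t_def indexed_pmult_def monomial_eval_closed[OF c])
  have t0: "t m = \<zero>" if "v \<notin># m" for m
    using that by (simp add: t_def indexed_pmult_def monomial_eval_closed[OF c])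
  have cv: "c v \<in> carrier R" using assms(2) c by auto
  show "monomial_subst V c g (indexed_pmult P v) n =
      indexed_pmult (\<lambda>n. c v \<otimes> monomial_subst V c g P n) (g v) n"
  proof (cases "g v \<in># n")
    case True
    then obtain n' where n: "n = add_mset (g v) n'"
      by (meson multi_member_split)
    \<comment> \<open>The term \<open>t m\<close> vanishes unless \<open>v\<close> divides
      \<open>m\<close>. Removing one \<open>v\<close> maps the remaining part of the fibre over
      \<open>n\<close> bijectively to the fibre over \<open>n'\<close>.\<close>
    have "(\<Oplus>m\<in>fib n. t m) = (\<Oplus>m\<in>add_mset v ` fib n'. t m)"
    proof (rule add.finprod_mono_neutral_cong_left[symmetric])
      show "t m = \<zero>" if "m \<in> fib n - add_mset v ` fib n'" for m
        using that by (intro t0) (auto simp: fib_def n dest!: multi_member_split)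
    qed (use assms(2) fin in \<open>auto simp: n t fib_def\<close>)
    also have "\<dots> = (\<Oplus>m\<in>fib n'. t (add_mset v m))"
      by (rule finsum_reindex) (auto simp: t inj_on_def)
    also have "\<dots> = (\<Oplus>m\<in>fib n'. c v \<otimes> (P m \<otimes> monomial_eval V c m))"
      using assms cv by (intro finsum_cong')
        (auto simp: t_def indexed_pmult_def monomial_eval_add_mset[OF finV c] monomial_eval_closed[OF c]
          m_lcomm)
    also have "\<dots> = c v \<otimes> (\<Oplus>m\<in>fib n'. P m \<otimes> monomial_eval V c m)"
      using assms cv fin by (intro finsum_rdistr[symmetric]) (auto simp: monomial_eval_closed[OF c])
    finally show ?thesis
      by (simp add: monomial_subst_def indexed_pmult_def n t_def fib_def)
  next
    case False
    then have "(\<Oplus>m\<in>fib n. t m) = \<zero>"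
      by (intro add.finprod_one_eqI t0) (auto simp: fib_def)
    then show ?thesis
      using False by (simp add: monomial_subst_def indexed_pmult_def t_def fib_def)
  qed
qed

lemma monomial_subst_closed:
  assumes "P \<in> indexed_pset V (carrier R)"
  shows "monomial_subst V c g P \<in> indexed_pset W (carrier R)"
  using assms
proof induction
  case (indexed_const k)
  then show ?case by (simp add: monomial_subst_const indexed_pset.indexed_const)
next
  case (indexed_padd P Q)
  then show ?case by (simp add: monomial_subst_padd indexed_pset.indexed_padd)
next
  case (indexed_pmult P v)
  then have "c v \<in> carrier R" "g v \<in> W" using c g by auto
  with indexed_pmult show ?case
    by (simp add: monomial_subst_pmult indexed_pset.indexed_pmult indexed_pset_smult)
qed

text \<open>Induction on the left factor. In the case of an indeterminate, the scalar
  \<open>c v\<close> and the shift by \<open>g v\<close> are pulled out of the product on both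
  sides.\<close>

lemma monomial_subst_mult:
  assumes "P \<in> indexed_pset V (carrier R)" "Q \<in> indexed_pset V (carrier R)"
  shows "monomial_subst V c g (P \<otimes>\<^bsub>mpoly_ring R V\<^esub> Q) =
    monomial_subst V c g P \<otimes>\<^bsub>mpoly_ring R W\<^esub> monomial_subst V c g Q"
  using assms
proof induction
  case (indexed_const k)
  have "monomial_subst V c g (\<lambda>m. k \<otimes> Q m) n = k \<otimes> monomial_subst V c g Q n" for n
    unfolding monomial_subst_def using indexed_const finite_monomial_fibre[OF finV, of g n]
    by (subst finsum_rdistr)
      (auto simp: monomial_eval_closed[OF c] m_assoc intro!: finsum_cong')
  then show ?case
    using indexed_const
    by (simp add: mpoly_mult_const monomial_subst_const monomial_subst_closed)
next
  case (indexed_padd P P')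
  then show ?case
    by (simp add: mpoly_mult_padd monomial_subst_padd monomial_subst_closed mpoly_mult_closed)
next
  case (indexed_pmult P v)
  interpret T: cring "mpoly_ring R W" by (rule mpoly_cring)
  let ?s = "monomial_subst V c g"
  have cv: "c v \<in> carrier R" using c indexed_pmult by auto
  have const: "indexed_const (c v) \<in> indexed_pset W (carrier R)"
    using cv by (rule indexed_pset.indexed_const)
  have s: "?s P \<in> indexed_pset W (carrier R)" "?s Q \<in> indexed_pset W (carrier R)"
    using indexed_pmult by (auto intro: monomial_subst_closed)
  have "?s (indexed_pmult P v \<otimes>\<^bsub>mpoly_ring R V\<^esub> Q) =
      indexed_pmult (indexed_const (c v) \<otimes>\<^bsub>mpoly_ring R W\<^esub> (?s P \<otimes>\<^bsub>mpoly_ring R W\<^esub> ?s Q)) (g v)"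
    using indexed_pmult s cv
    by (simp add: mpoly_mult_pmult monomial_subst_pmult mpoly_mult_closed mpoly_mult_const)
  also have "\<dots> = indexed_pmult (indexed_const (c v) \<otimes>\<^bsub>mpoly_ring R W\<^esub> ?s P) (g v)
      \<otimes>\<^bsub>mpoly_ring R W\<^esub> ?s Q"
    using s const by (simp add: mpoly_mult_pmult mpoly_mult_closed mpoly_mult_assoc)
  finally show ?case
    using indexed_pmult s cv by (simp add: monomial_subst_pmult mpoly_mult_const)
qed

lemma monomial_subst_hom: "monomial_subst V c g \<in> ring_hom (mpoly_ring R V) (mpoly_ring R W)"
  by (rule ring_hom_memI)
    (auto simp: monomial_subst_closed monomial_subst_mult mpoly_add monomial_subst_padd
      mpoly_one monomial_subst_const)

lemma monomial_subst_var:
  assumes "v \<in> V"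
  shows "monomial_subst V c g (indexed_var v) =
    indexed_const (c v) \<otimes>\<^bsub>mpoly_ring R W\<^esub> indexed_var (g v)"
proof -
  have cv: "c v \<in> carrier R" "g v \<in> W" using c g assms by auto
  have "monomial_subst V c g (indexed_var v) = indexed_pmult (\<lambda>n. c v \<otimes> indexed_const \<one> n) (g v)"
    using assms
    by (simp add: indexed_var_def monomial_subst_pmult monomial_subst_const indexed_pset.indexed_const)
  also have "(\<lambda>n. c v \<otimes> indexed_const \<one> n) = (indexed_const (c v) :: 'w multiset \<Rightarrow> 'a)"
    using cv by (auto simp: indexed_const_def)
  also have "indexed_pmult (indexed_const (c v)) (g v) =
      indexed_const (c v) \<otimes>\<^bsub>mpoly_ring R W\<^esub> indexed_var (g v)"
    using cv by (intro mpoly_pmult_eq indexed_pset.indexed_const)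
  finally show ?thesis .
qed

text \<open>Distinct monomials in the indeterminates from \<open>J\<close> have distinct images, so
  no cancellation occurs: the coefficient at the image of \<open>m\<close> is \<open>P m\<close>
  times the value of \<open>m\<close> at \<open>c\<close>, which is a nonzerodivisor.\<close>

lemma monomial_subst_inj:
  assumes "J \<subseteq> V" "inj_on g J" "\<And>v. v \<in> J \<Longrightarrow> nonzerodivisor R (c v)"
    and P: "P \<in> indexed_pset J (carrier R)" and zero: "monomial_subst V c g P = (\<lambda>n. \<zero>)"
  shows "P = (\<lambda>m. \<zero>)"
proof
  fix m
  show "P m = \<zero>"
  proof (cases "set_mset m \<subseteq> J")
    case True
    \<comment> \<open>The substitution sums over all monomials in \<open>V\<close>, so the fibre may
      also contain monomials outside \<open>J\<close>; the polynomial \<open>P\<close> has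
      coefficient zero at those.\<close>
    define fib where "fib = {m'. set_mset m' \<subseteq> V \<and> image_mset g m' = image_mset g m}"
    have m: "m \<in> fib" "finite fib"
      using True assms(1) finite_monomial_fibre[OF finV] by (auto simp: fib_def)
    have eq: "m' = m" if "m' \<in> fib" "set_mset m' \<subseteq> J" for m'
    proof (rule multiset.inj_map_strong)
      show "v = w" if "v \<in># m'" "w \<in># m" "g v = g w" for v w
        using that \<open>set_mset m' \<subseteq> J\<close> True assms(2) by (auto dest: inj_onD)
      show "image_mset g m' = image_mset g m"
        using \<open>m' \<in> fib\<close> by (simp add: fib_def)
    qed
    have zero_coeff: "P m' = \<zero>" if "m' \<in> fib" "m \<noteq> m'" for m'
      using that eq indexed_pset_support[OF P] by blast
    have "(\<Oplus>m'\<in>fib. P m' \<otimes> monomial_eval V c m') =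
        (\<Oplus>m'\<in>fib. if m = m' then P m' \<otimes> monomial_eval V c m' else \<zero>)"
      using P zero_coeff by (intro finsum_cong') (auto simp: monomial_eval_closed[OF c])
    also have "\<dots> = P m \<otimes> monomial_eval V c m"
      using P m by (intro finsum_singleton) (auto simp: monomial_eval_closed[OF c])
    finally have "monomial_eval V c m \<otimes> P m = \<zero>"
      using fun_cong[OF zero, of "image_mset g m"] P
      by (simp add: monomial_subst_def fib_def m_comm monomial_eval_closed[OF c])
    moreover have "nonzerodivisor R (monomial_eval V c m)"
      using finV True assms(3) by (intro monomial_eval_nonzerodivisor) auto
    ultimately show ?thesis
      using P by (simp add: nonzerodivisor_def)
  next
    case False
    then show ?thesis by (rule indexed_pset_support[OF P])
  qed
qed

end

section \<open>Constants, indeterminates and uniqueness of homomorphisms\<close>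

lemma indexed_pset_mono: "P \<in> indexed_pset J K \<Longrightarrow> J \<subseteq> V \<Longrightarrow> P \<in> indexed_pset V K"
  by (induction rule: indexed_pset.induct) (auto intro: indexed_pset.intros)

lemma indexed_var_closed: "v \<in> V \<Longrightarrow> indexed_var v \<in> indexed_pset V (carrier R)"
  unfolding indexed_var_def by (intro indexed_pset.intros) auto

lemma mpoly_const_mult:
  assumes "a \<in> carrier R" "b \<in> carrier R"
  shows "indexed_const a \<otimes>\<^bsub>mpoly_ring R V\<^esub> indexed_const b = indexed_const (a \<otimes> b)"
  using assms mpoly_mult_const[of a "indexed_const b" V]
  by (auto simp: indexed_const_def indexed_pset.indexed_const[unfolded indexed_const_def])

lemma mpoly_const_pow:
  assumes "a \<in> carrier R"
  shows "indexed_const a [^]\<^bsub>mpoly_ring R V\<^esub> (k :: nat) = indexed_const (a [^] k)"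
  using assms by (induction k) (simp_all add: mpoly_one mpoly_const_mult)

text \<open>Every polynomial is built from constants by sums and products with indeterminates. This
  serves to compare an arbitrary presentation with the explicit substitution.\<close>

lemma mpoly_hom_unique:
  assumes \<phi>: "\<phi> \<in> ring_hom (mpoly_ring R V) T" and \<psi>: "\<psi> \<in> ring_hom (mpoly_ring R V) T"
    and const: "\<And>k. k \<in> carrier R \<Longrightarrow> \<phi> (indexed_const k) = \<psi> (indexed_const k)"
    and var: "\<And>v. v \<in> V \<Longrightarrow> \<phi> (indexed_var v) = \<psi> (indexed_var v)"
    and "P \<in> indexed_pset V (carrier R)"
  shows "\<phi> P = \<psi> P"
  using assms(5)
proof induction
  case (indexed_const k)
  then show ?case by (rule const)
next
  case (indexed_padd P Q)
  then show ?case
    using ring_hom_add[OF \<phi>, of P Q] ring_hom_add[OF \<psi>, of P Q] by (simp add: mpoly_add)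
next
  case (indexed_pmult P v)
  then show ?case
    using ring_hom_mult[OF \<phi>, of P "indexed_var v"] ring_hom_mult[OF \<psi>, of P "indexed_var v"] var
    by (simp add: mpoly_pmult_eq indexed_var_closed)
qed

end


section \<open>Elimination of variables modulo an ideal\<close>

context cring
begin

text \<open>This and the next three identities are applied in polynomial rings. Modulo an ideal, the
  present one combines \<open>k p = q\<close> and \<open>h y = b\<close> into
  \<open>(k h) (p y) = q b\<close>.\<close>

lemma mult_minus_telescope:
  assumes "h \<in> carrier R" "p \<in> carrier R" "q \<in> carrier R" "y \<in> carrier R" "b \<in> carrier R" "k \<in> carrier R"
  shows "(k \<otimes> h) \<otimes> (p \<otimes> y) \<ominus> q \<otimes> b = (k \<otimes> p \<ominus> q) \<otimes> (h \<otimes> y) \<oplus> q \<otimes> (h \<otimes> y \<ominus> b)"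
  using assms by algebra

text \<open>Modulo an ideal, \<open>k p = q\<close> and \<open>k' p' = q'\<close> are added after
  passing to the common multiplier \<open>k k'\<close>.\<close>

lemma add_minus_telescope:
  assumes "k \<in> carrier R" "k' \<in> carrier R" "p \<in> carrier R" "p' \<in> carrier R"
    "q \<in> carrier R" "q' \<in> carrier R"
  shows "(k \<otimes> k') \<otimes> (p \<oplus> p') \<ominus> (k' \<otimes> q \<oplus> k \<otimes> q') = k' \<otimes> (k \<otimes> p \<ominus> q) \<oplus> k \<otimes> (k' \<otimes> p' \<ominus> q')"
  using assms by algebra

lemma mult_swap_minus:
  assumes "a \<in> carrier R" "b \<in> carrier R" "t \<in> carrier R"
  shows "(a \<otimes> t) \<otimes> b \<ominus> (b \<otimes> t) \<otimes> a = \<zero>"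
  using assms by algebra

lemma mult_minus_swap:
  assumes "a \<in> carrier R" "b \<in> carrier R" "b' \<in> carrier R" "x \<in> carrier R" "y \<in> carrier R"
  shows "a \<otimes> (x \<otimes> b \<ominus> y \<otimes> b') = (a \<otimes> b) \<otimes> x \<ominus> (a \<otimes> b') \<otimes> y"
  using assms by algebra

text \<open>Induction on \<open>P\<close>, collecting powers of \<open>h\<close>: constants need
  none, a sum uses the product of the two powers, and each multiplication by an indeterminate costs
  one further factor \<open>h\<close>, which trades it for a multiple of an indeterminate from
  \<open>J\<close>.\<close>

lemma reduce_to_subvariables:
  assumes L: "ideal L (mpoly_ring R V)" and J: "J \<subseteq> V" and h: "h \<in> carrier R"
    and rel: "\<And>v. v \<in> V \<Longrightarrow> \<exists>w\<in>J. \<exists>a\<in>carrier R.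
      indexed_const h \<otimes>\<^bsub>mpoly_ring R V\<^esub> indexed_var v
        \<ominus>\<^bsub>mpoly_ring R V\<^esub> indexed_const a \<otimes>\<^bsub>mpoly_ring R V\<^esub> indexed_var w \<in> L"
    and P: "P \<in> indexed_pset V (carrier R)"
  shows "\<exists>k. \<exists>Q\<in>indexed_pset J (carrier R).
    indexed_const (h [^] (k :: nat)) \<otimes>\<^bsub>mpoly_ring R V\<^esub> P \<ominus>\<^bsub>mpoly_ring R V\<^esub> Q \<in> L"
  using P
proof induction
  interpret S: cring "mpoly_ring R V" by (rule mpoly_cring)
  interpret L: ideal L "mpoly_ring R V" by (rule L)
  note L_add = additive_subgroup.a_closed[OF L.additive_subgroup_axioms]
  have JV: "Q \<in> carrier (mpoly_ring R V)" if "Q \<in> indexed_pset J (carrier R)" for Q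
    using indexed_pset_mono[OF that J] by simp
  have const: "indexed_const k \<in> carrier (mpoly_ring R V)" if "k \<in> carrier R" for k
    using that by (simp add: indexed_pset.indexed_const)
  have smult: "indexed_const k \<otimes>\<^bsub>mpoly_ring R V\<^esub> Q \<in> indexed_pset J (carrier R)"
    if "k \<in> carrier R" "Q \<in> indexed_pset J (carrier R)" for k Q
    using that JV by (simp add: mpoly_mult_const indexed_pset_smult)
  {
    case (indexed_const k)
    have "indexed_const (h [^] (0 :: nat)) \<otimes>\<^bsub>mpoly_ring R V\<^esub> indexed_const k
        \<ominus>\<^bsub>mpoly_ring R V\<^esub> indexed_const k = \<zero>\<^bsub>mpoly_ring R V\<^esub>"
      using const[OF indexed_const] S.l_one[OF const[OF indexed_const]]
      by (simp del: mpoly_carrier add: S.r_neg S.minus_eq mpoly_one)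
    then show ?case
      using indexed_const by (metis L.zero_closed indexed_pset.indexed_const)
  next
    case (indexed_padd P P')
    then obtain k Q k' Q' where
      Q: "Q \<in> indexed_pset J (carrier R)"
        "indexed_const (h [^] (k :: nat)) \<otimes>\<^bsub>mpoly_ring R V\<^esub> P \<ominus>\<^bsub>mpoly_ring R V\<^esub> Q \<in> L" and
      Q': "Q' \<in> indexed_pset J (carrier R)"
        "indexed_const (h [^] (k' :: nat)) \<otimes>\<^bsub>mpoly_ring R V\<^esub> P' \<ominus>\<^bsub>mpoly_ring R V\<^esub> Q' \<in> L"
      by blast
    let ?H = "\<lambda>k :: nat. indexed_const (h [^] k)"
    \<comment> \<open>The two reductions use different powers of \<open>h\<close>, so each remainder
      is multiplied by the power belonging to the other summand.\<close>
    let ?Q = "indexed_padd (?H k' \<otimes>\<^bsub>mpoly_ring R V\<^esub> Q) (?H k \<otimes>\<^bsub>mpoly_ring R V\<^esub> Q')"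
    have H: "?H k \<in> carrier (mpoly_ring R V)" for k
      using h by (intro const) simp
    have HH: "?H (k + k') = ?H k \<otimes>\<^bsub>mpoly_ring R V\<^esub> ?H k'"
      using h by (simp add: mpoly_const_mult nat_pow_mult)
    have "?H (k + k') \<otimes>\<^bsub>mpoly_ring R V\<^esub> indexed_padd P P' \<ominus>\<^bsub>mpoly_ring R V\<^esub> ?Q \<in> L"
      unfolding HH mpoly_add[where V = V, symmetric]
      using Q Q' H indexed_padd.hyps JV
      by (subst S.add_minus_telescope) (auto intro!: L_add L.I_l_closed simp del: mpoly_carrier simp: mpoly_carrier[symmetric])
    moreover have "?Q \<in> indexed_pset J (carrier R)"
      using Q Q' h by (intro indexed_pset.indexed_padd smult) auto
    ultimately show ?case by blast
  next
    case (indexed_pmult P v)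
    then obtain k Q w a where
      Q: "Q \<in> indexed_pset J (carrier R)"
        "indexed_const (h [^] (k :: nat)) \<otimes>\<^bsub>mpoly_ring R V\<^esub> P \<ominus>\<^bsub>mpoly_ring R V\<^esub> Q \<in> L" and
      w: "w \<in> J" "a \<in> carrier R"
        "indexed_const h \<otimes>\<^bsub>mpoly_ring R V\<^esub> indexed_var v
          \<ominus>\<^bsub>mpoly_ring R V\<^esub> indexed_const a \<otimes>\<^bsub>mpoly_ring R V\<^esub> indexed_var w \<in> L"
      using rel by blast
    let ?H = "indexed_const (h [^] k)"
    let ?b = "indexed_const a \<otimes>\<^bsub>mpoly_ring R V\<^esub> indexed_var w"
    have H: "?H \<in> carrier (mpoly_ring R V)" "indexed_const h \<in> carrier (mpoly_ring R V)"
      using h by (auto intro!: const simp del: mpoly_carrier)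
    have vars: "indexed_var v \<in> carrier (mpoly_ring R V)" "indexed_var w \<in> carrier (mpoly_ring R V)"
      using indexed_pmult w J by (auto intro: indexed_var_closed)
    have b: "?b \<in> carrier (mpoly_ring R V)"
      using const[OF w(2)] vars by (rule_tac S.m_closed)
    have HH: "indexed_const (h [^] Suc k) = ?H \<otimes>\<^bsub>mpoly_ring R V\<^esub> indexed_const h"
      using h by (simp add: mpoly_const_mult)
    have P: "P \<in> carrier (mpoly_ring R V)" using indexed_pmult by simp
    have "indexed_const (h [^] Suc k) \<otimes>\<^bsub>mpoly_ring R V\<^esub> indexed_pmult P v
        \<ominus>\<^bsub>mpoly_ring R V\<^esub> Q \<otimes>\<^bsub>mpoly_ring R V\<^esub> ?b \<in> L"
      unfolding HH mpoly_pmult_eq[OF indexed_pmult.hyps]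
        S.mult_minus_telescope[OF H(2) P JV[OF Q(1)] vars(1) b H(1)]
      using Q w H vars JV by (intro L_add L.I_l_closed L.I_r_closed S.m_closed) auto
    \<comment> \<open>Rewriting the remainder with the constructor \<open>indexed_pmult\<close>
      shows that it involves only indeterminates from \<open>J\<close>.\<close>
    moreover have "Q \<otimes>\<^bsub>mpoly_ring R V\<^esub> ?b = indexed_pmult (indexed_const a \<otimes>\<^bsub>mpoly_ring R V\<^esub> Q) w"
    proof -
      have "indexed_pmult (indexed_const a \<otimes>\<^bsub>mpoly_ring R V\<^esub> Q) w =
          (indexed_const a \<otimes>\<^bsub>mpoly_ring R V\<^esub> Q) \<otimes>\<^bsub>mpoly_ring R V\<^esub> indexed_var w"
        using S.m_closed[OF const[OF w(2)] JV[OF Q(1)]] w(1) J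
        by (intro mpoly_pmult_eq) auto
      then show ?thesis
        using const[OF w(2)] JV[OF Q(1)] vars(2) by (simp only: S.m_ac)
    qed
    moreover have "indexed_pmult (indexed_const a \<otimes>\<^bsub>mpoly_ring R V\<^esub> Q) w \<in> indexed_pset J (carrier R)"
      using w Q by (intro indexed_pset.indexed_pmult smult)
    ultimately show ?case by metis
  }
qed

end


section \<open>The defining ideal of the multi-Rees algebra\<close>

theorem theorem2p1:
  fixes R :: "('a, 'r) ring_scheme"
    and s :: nat
    and I :: "nat \<Rightarrow> 'a set"
    and n :: "nat \<Rightarrow> nat"
    and f :: "nat \<Rightarrow> nat \<Rightarrow> 'a"
    and jj :: "nat \<Rightarrow> nat"
  defines "RY \<equiv> mpoly_ring R (Y_indices s n)"
  defines "h \<equiv> (\<Otimes>\<^bsub>R\<^esub>i\<in>{1..s}. f i (jj i))"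
  defines "\<Gamma> \<equiv> saturation RY
      (Idl\<^bsub>RY\<^esub> {(mpoly_var R (i, j) \<otimes>\<^bsub>RY\<^esub> mpoly_const R (f i j'))
                \<ominus>\<^bsub>RY\<^esub> (mpoly_var R (i, j') \<otimes>\<^bsub>RY\<^esub> mpoly_const R (f i j))
              | i j j'. i \<in> {1..s} \<and> j \<in> {1..n i} \<and> j' \<in> {1..n i}})
      (mpoly_const R h)"
  assumes "cring R" and "noetherian_ring R"
    and "\<And>i. i \<in> {1..s} \<Longrightarrow> ideal (I i) R"
    and "\<And>i. i \<in> {1..s} \<Longrightarrow> grade R (I i) > 0"
    and "\<And>i j. i \<in> {1..s} \<Longrightarrow> j \<in> {1..n i} \<Longrightarrow> f i j \<in> carrier R"
    and "\<And>i. i \<in> {1..s} \<Longrightarrow> I i = Idl\<^bsub>R\<^esub> (f i ` {1..n i})"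
    and "\<And>i. i \<in> {1..s} \<Longrightarrow> jj i \<in> {1..n i}"
    and "\<And>i. i \<in> {1..s} \<Longrightarrow> nonzerodivisor R (f i (jj i))"
  shows "(\<exists>\<phi>. is_Rees_presentation R s n I f \<phi>) \<and>
         (\<forall>\<phi>. is_Rees_presentation R s n I f \<phi> \<longrightarrow>
            \<Gamma> = a_kernel RY (multi_Rees R s I) \<phi>)"
proof -
  interpret cring R by fact
  define V where "V = Y_indices s n"
  define RT :: "(nat multiset \<Rightarrow> 'a) ring" where "RT = mpoly_ring R {1..s}"
  define c where "c = (\<lambda>(i, j). f i j)"
  \<comment> \<open>The substitution with \<open>g = fst\<close> sends the indeterminate at
    \<open>(i, j)\<close> to \<open>f i j\<close> times the \<open>i\<close>-th indeterminate of
    \<open>RT\<close>; it will be the witness for existence.\<close>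
  define \<psi> where "\<psi> = monomial_subst V c (fst :: nat \<times> nat \<Rightarrow> nat)"
  \<comment> \<open>On these indices \<open>fst\<close> is injective and \<open>c\<close> takes
    nonzerodivisor values, as \<open>monomial_subst_inj\<close> requires.\<close>
  define J where "J = (\<lambda>i. (i, jj i)) ` {1..s}"
  define G where "G = {(mpoly_var R (i, j) \<otimes>\<^bsub>RY\<^esub> mpoly_const R (f i j'))
                \<ominus>\<^bsub>RY\<^esub> (mpoly_var R (i, j') \<otimes>\<^bsub>RY\<^esub> mpoly_const R (f i j))
              | i j j'. i \<in> {1..s} \<and> j \<in> {1..n i} \<and> j' \<in> {1..n i}}"
  have RY: "RY = mpoly_ring R V" by (simp add: RY_def V_def)
  interpret RY: cring RY unfolding RY by (rule mpoly_cring)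
  interpret RT: cring RT unfolding RT_def by (rule mpoly_cring)
  have V: "(i, j) \<in> V \<longleftrightarrow> i \<in> {1..s} \<and> j \<in> {1..n i}" for i j
    by (auto simp: V_def Y_indices_def)
  have finV: "finite V" by (simp add: V_def Y_indices_def)
  have c: "c \<in> V \<rightarrow> carrier R" using assms(8) by (auto simp: c_def V_def Y_indices_def)
  have fstV: "fst \<in> V \<rightarrow> {1..s}" by (auto simp: V_def Y_indices_def)
  have JV: "J \<subseteq> V" using assms(10) by (auto simp: J_def V)
  have nzd: "nonzerodivisor R (c v)" if "v \<in> J" for v
    using that assms(11) by (auto simp: J_def c_def)
  have h: "nonzerodivisor R h"
    unfolding h_def using assms(11) by (intro nonzerodivisor_finprod) auto
  then have hR: "h \<in> carrier R" by (simp add: nonzerodivisor_def)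
  have const: "mpoly_const R a \<in> carrier RY" "mpoly_const R a \<in> carrier RT" if "a \<in> carrier R" for a
    using that by (simp_all add: RY RT_def indexed_pset.indexed_const)
  have var: "mpoly_var R v \<in> carrier RY" if "v \<in> V" for v
    using that by (simp add: RY indexed_var_closed)
  have varT: "mpoly_var R i \<in> carrier RT" if "i \<in> {1..s}" for i
    using that unfolding RT_def mpoly_carrier by (rule indexed_var_closed)

  \<comment> \<open>Existence and uniqueness of the presentation\<close>
  note hom = monomial_subst_hom[OF finV c fstV, folded \<psi>_def RY RT_def]
  interpret \<psi>: ring_hom_cring RY RT \<psi>
    by (rule UnivPoly.ring_hom_cringI[OF RY.cring_axioms RT.cring_axioms hom])
  have \<psi>_const: "\<psi> (mpoly_const R a) = mpoly_const R a" if "a \<in> carrier R" for a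
    unfolding \<psi>_def by (rule monomial_subst_const[OF finV c fstV that])
  have \<psi>_var: "\<psi> (mpoly_var R (i, j)) = mpoly_const R (f i j) \<otimes>\<^bsub>RT\<^esub> mpoly_var R i"
    if "i \<in> {1..s}" "j \<in> {1..n i}" for i j
    using monomial_subst_var[OF finV c fstV, of "(i, j)"] that by (simp add: \<psi>_def V c_def RT_def)

  define gens where "gens = mpoly_const R ` carrier R \<union>
    {mpoly_const R a \<otimes>\<^bsub>RT\<^esub> mpoly_var R i | i a. i \<in> {1..s} \<and> a \<in> I i}"
  have Rees: "multi_Rees R s I = RT \<lparr> carrier := generate_ring RT gens \<rparr>"
    by (simp add: multi_Rees_def RT_def gens_def Let_def)
  have fI: "f i j \<in> I i" if "i \<in> {1..s}" "j \<in> {1..n i}" for i j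
  proof -
    have "f i ` {1..n i} \<subseteq> carrier R" using that(1) assms(8) by auto
    then show ?thesis using that assms(9) genideal_self by blast
  qed
  \<comment> \<open>So far \<open>\<psi>\<close> maps into the full polynomial ring
    \<open>RT\<close>. A presentation must take values in the multi-Rees algebra, whose carrier is
    the subring generated by \<open>gens\<close>.\<close>
  have range: "\<psi> P \<in> generate_ring RT gens" if "P \<in> indexed_pset V (carrier R)" for P
    using that
  proof induction
    case (indexed_const k)
    then show ?case by (auto simp: \<psi>_const gens_def intro!: generate_ring.incl)
  next
    case (indexed_padd P Q)
    then show ?case
      using \<psi>.hom_add[of P Q] generate_ring.eng_add[of "\<psi> P" RT gens "\<psi> Q"]
      by (simp add: RY mpoly_add)
  next
    case (indexed_pmult P v)
    obtain i j where v: "v = (i, j)" by (cases v)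
    then have ij: "i \<in> {1..s}" "j \<in> {1..n i}" using indexed_pmult V by auto
    have "\<psi> (indexed_pmult P v) = \<psi> P \<otimes>\<^bsub>RT\<^esub> (mpoly_const R (f i j) \<otimes>\<^bsub>RT\<^esub> mpoly_var R i)"
      using indexed_pmult.hyps var[OF indexed_pmult.hyps(2)] \<psi>_var[OF ij] \<psi>.hom_mult[of P "mpoly_var R v"]
      by (simp add: mpoly_pmult_eq RY v)
    moreover have "mpoly_const R (f i j) \<otimes>\<^bsub>RT\<^esub> mpoly_var R i \<in> generate_ring RT gens"
      using ij fI[OF ij] by (intro generate_ring.incl) (auto simp: gens_def)
    ultimately show ?case
      using indexed_pmult.IH by (simp add: generate_ring.eng_mult)
  qed
  have hom': "\<psi> \<in> ring_hom RY (multi_Rees R s I)"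
    using range hom by (auto simp: Rees ring_hom_def RY)
  have pres: "is_Rees_presentation R s n I f \<psi>"
    using hom' \<psi>_const \<psi>_var by (simp add: is_Rees_presentation_def RY_def RT_def)
  \<comment> \<open>All presentations agree with \<open>\<psi>\<close> on the carrier of
    \<open>RY\<close>, so it suffices to compute the kernel of \<open>\<psi>\<close>.\<close>
  have unique: "\<phi> P = \<psi> P" if "is_Rees_presentation R s n I f \<phi>" "P \<in> carrier RY" for \<phi> P
  proof (rule mpoly_hom_unique[where V = V and T = "multi_Rees R s I"])
    show "\<phi> \<in> ring_hom (mpoly_ring R V) (multi_Rees R s I)"
      using that(1) by (simp add: is_Rees_presentation_def V_def)
    show "\<phi> (mpoly_var R v) = \<psi> (mpoly_var R v)" if "v \<in> V" for v
      using that \<psi>_var V \<open>is_Rees_presentation R s n I f \<phi>\<close>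
      by (cases v) (auto simp: is_Rees_presentation_def RT_def)
  qed (use that hom' \<psi>_const in \<open>auto simp: RY is_Rees_presentation_def\<close>)

  \<comment> \<open>The kernel as a saturation\<close>
  have ker: "P \<in> a_kernel RY RT \<psi> \<longleftrightarrow> P \<in> carrier RY \<and> \<psi> P = \<zero>\<^bsub>RT\<^esub>" for P
    by (simp only: a_kernel_def' mem_Collect_eq)
  have GV: "G \<subseteq> carrier RY"
    using assms(8) var const V by (auto simp: G_def)
  define L where "L = Idl\<^bsub>RY\<^esub> G"
  interpret L: ideal L RY unfolding L_def by (rule RY.genideal_ideal[OF GV])
  \<comment> \<open>Both terms of a generator map to \<open>f i j\<close> times
    \<open>f i j'\<close> times the \<open>i\<close>-th indeterminate, so their difference maps to
    zero.\<close>
  have LK: "L \<subseteq> a_kernel RY RT \<psi>"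
    unfolding L_def
  proof (rule RY.genideal_minimal[OF \<psi>.ring.kernel_is_ideal], rule subsetI)
    fix x assume "x \<in> G"
    then obtain i j j' where ij: "i \<in> {1..s}" "j \<in> {1..n i}" "j' \<in> {1..n i}" and
      x: "x = (mpoly_var R (i, j) \<otimes>\<^bsub>RY\<^esub> mpoly_const R (f i j'))
                \<ominus>\<^bsub>RY\<^esub> (mpoly_var R (i, j') \<otimes>\<^bsub>RY\<^esub> mpoly_const R (f i j))"
      by (auto simp: G_def)
    have vars: "mpoly_var R (i, j) \<in> carrier RY" "mpoly_var R (i, j') \<in> carrier RY"
      using ij by (auto intro: var simp: V)
    have fR: "f i j \<in> carrier R" "f i j' \<in> carrier R"
      using ij assms(8) by auto
    note cl = const(2)[OF fR(1)] const(2)[OF fR(2)] varT[OF ij(1)]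
    have "\<psi> x = (mpoly_const R (f i j) \<otimes>\<^bsub>RT\<^esub> mpoly_var R i) \<otimes>\<^bsub>RT\<^esub> mpoly_const R (f i j')
        \<ominus>\<^bsub>RT\<^esub> (mpoly_const R (f i j') \<otimes>\<^bsub>RT\<^esub> mpoly_var R i) \<otimes>\<^bsub>RT\<^esub> mpoly_const R (f i j)"
      using const(1)[OF fR(1)] const(1)[OF fR(2)] vars
      by (simp add: x RY.minus_eq RT.minus_eq \<psi>_const[OF fR(1)] \<psi>_const[OF fR(2)]
          \<psi>_var[OF ij(1,2)] \<psi>_var[OF ij(1,3)])
    also have "\<dots> = \<zero>\<^bsub>RT\<^esub>"
      using cl by (simp add: RT.mult_swap_minus)
    finally have "\<psi> x = \<zero>\<^bsub>RT\<^esub>" .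
    then show "x \<in> a_kernel RY RT \<psi>"
      unfolding ker using \<open>x \<in> G\<close> GV by blast
  qed
  have rel: "\<exists>w\<in>J. \<exists>a\<in>carrier R. mpoly_const R h \<otimes>\<^bsub>RY\<^esub> mpoly_var R v
      \<ominus>\<^bsub>RY\<^esub> mpoly_const R a \<otimes>\<^bsub>RY\<^esub> mpoly_var R w \<in> L" if "v \<in> V" for v
  proof -
    obtain i j where v: "v = (i, j)" by (cases v)
    then have ij: "i \<in> {1..s}" "j \<in> {1..n i}" using that V by auto
    note jj = assms(10)[OF ij(1)]
    \<comment> \<open>With \<open>h'\<close> the product of the other chosen nonzerodivisors,
      \<open>h\<close> equals \<open>h'\<close> times \<open>f i (jj i)\<close>. Multiplying the
      generator for \<open>j\<close> and \<open>jj i\<close> by \<open>h'\<close> gives the relation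
      for the full \<open>h\<close>, with witness \<open>a\<close> equal to \<open>h'\<close> times
      \<open>f i j\<close>.\<close>
    define h' where "h' = (\<Otimes>\<^bsub>R\<^esub>i\<in>{1..s} - {i}. f i (jj i))"
    have h': "h' \<in> carrier R"
      unfolding h'_def using assms(8,10) by (intro finprod_closed) auto
    have "h = (\<Otimes>\<^bsub>R\<^esub>i\<in>insert i ({1..s} - {i}). f i (jj i))"
      unfolding h_def using ij(1) by (simp add: insert_absorb)
    also have "\<dots> = f i (jj i) \<otimes>\<^bsub>R\<^esub> h'"
      unfolding h'_def using assms(8,10) ij(1) by (intro finprod_insert) auto
    finally have h: "mpoly_const R h = mpoly_const R h' \<otimes>\<^bsub>RY\<^esub> mpoly_const R (f i (jj i))"
      using h' assms(8)[OF ij(1) jj] by (simp add: RY mpoly_const_mult m_comm)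
    have h'f: "mpoly_const R (h' \<otimes>\<^bsub>R\<^esub> f i j) = mpoly_const R h' \<otimes>\<^bsub>RY\<^esub> mpoly_const R (f i j)"
      using h' assms(8)[OF ij] by (simp add: RY mpoly_const_mult)
    let ?g = "(mpoly_var R (i, j) \<otimes>\<^bsub>RY\<^esub> mpoly_const R (f i (jj i)))
                \<ominus>\<^bsub>RY\<^esub> (mpoly_var R (i, jj i) \<otimes>\<^bsub>RY\<^esub> mpoly_const R (f i j))"
    have "?g \<in> G" unfolding G_def using ij jj by blast
    then have "?g \<in> L" unfolding L_def using RY.genideal_self[OF GV] by blast
    then have "mpoly_const R h' \<otimes>\<^bsub>RY\<^esub> ?g \<in> L"
      using const h' by (intro L.I_l_closed)
    also have "mpoly_const R h' \<otimes>\<^bsub>RY\<^esub> ?g = mpoly_const R h \<otimes>\<^bsub>RY\<^esub> mpoly_var R v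
        \<ominus>\<^bsub>RY\<^esub> mpoly_const R (h' \<otimes>\<^bsub>R\<^esub> f i j) \<otimes>\<^bsub>RY\<^esub> mpoly_var R (i, jj i)"
    proof -
      have "mpoly_const R h' \<in> carrier RY" "mpoly_const R (f i j) \<in> carrier RY"
        "mpoly_const R (f i (jj i)) \<in> carrier RY"
        "mpoly_var R (i, j) \<in> carrier RY" "mpoly_var R (i, jj i) \<in> carrier RY"
        using h' ij jj assms(8) const var V by auto
      then show ?thesis
        unfolding h h'f v by (intro RY.mult_minus_swap)
    qed
    finally show ?thesis
      using imageI[OF ij(1), of "\<lambda>i. (i, jj i)"] m_closed[OF h' assms(8)[OF ij]]
      unfolding J_def by blast
  qed
  have "\<Gamma> = a_kernel RY RT \<psi>"
  proof (intro equalityI subsetI)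
    fix P assume "P \<in> \<Gamma>"
    then obtain k :: nat where P: "P \<in> carrier RY" and k: "mpoly_const R h [^]\<^bsub>RY\<^esub> k \<otimes>\<^bsub>RY\<^esub> P \<in> L"
      by (auto simp: \<Gamma>_def saturation_def L_def G_def)
    have hk: "h [^]\<^bsub>R\<^esub> k \<in> carrier R" using hR by simp
    \<comment> \<open>Applying \<open>\<psi>\<close> to the element of \<open>L\<close> multiplies
      every coefficient of \<open>\<psi> P\<close> by a power of \<open>h\<close>, which can be
      cancelled.\<close>
    have "\<zero>\<^bsub>RT\<^esub> = \<psi> (mpoly_const R (h [^]\<^bsub>R\<^esub> k) \<otimes>\<^bsub>RY\<^esub> P)"
      using k LK hR by (auto simp: ker mpoly_const_pow RY)
    also have "\<dots> = mpoly_const R (h [^]\<^bsub>R\<^esub> k) \<otimes>\<^bsub>RT\<^esub> \<psi> P"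
      using P const hk by (simp add: \<psi>_const)
    finally have "(\<lambda>m. h [^]\<^bsub>R\<^esub> k \<otimes>\<^bsub>R\<^esub> \<psi> P m) = (\<lambda>m. \<zero>\<^bsub>R\<^esub>)"
      using \<psi>.hom_closed[OF P] hk by (simp add: RT_def mpoly_mult_const mpoly_zero)
    then have "\<psi> P m = \<zero>\<^bsub>R\<^esub>" for m
      using nonzerodivisor_pow[OF h, of k] \<psi>.hom_closed[OF P]
      by (auto simp: nonzerodivisor_def RT_def fun_eq_iff)
    then show "P \<in> a_kernel RY RT \<psi>"
      unfolding ker using P by (auto simp: RT_def mpoly_zero)
  next
    fix P assume "P \<in> a_kernel RY RT \<psi>"
    then have P: "P \<in> carrier RY" "\<psi> P = \<zero>\<^bsub>RT\<^esub>" by (auto simp: ker)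
    obtain k :: nat and Q where Q: "Q \<in> indexed_pset J (carrier R)"
      and kL: "mpoly_const R (h [^]\<^bsub>R\<^esub> k) \<otimes>\<^bsub>RY\<^esub> P \<ominus>\<^bsub>RY\<^esub> Q \<in> L"
      using reduce_to_subvariables[OF L.ideal_axioms[unfolded RY] JV hR rel[unfolded RY], of P] P(1)
      by (auto simp: RY)
    have QR: "Q \<in> carrier RY" using indexed_pset_mono[OF Q JV] by (simp add: RY)
    have hk: "mpoly_const R (h [^]\<^bsub>R\<^esub> k) \<in> carrier RY" using hR const by simp
    \<comment> \<open>Since \<open>\<psi>\<close> kills both \<open>L\<close> and \<open>P\<close>,
      it kills \<open>Q\<close>. Injectivity on polynomials in \<open>J\<close> then gives
      \<open>Q = 0\<close>, so the multiple of \<open>P\<close> itself lies in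
      \<open>L\<close>.\<close>
    have "\<psi> (mpoly_const R (h [^]\<^bsub>R\<^esub> k) \<otimes>\<^bsub>RY\<^esub> P \<ominus>\<^bsub>RY\<^esub> Q) = \<zero>\<^bsub>RT\<^esub>"
      using kL LK by (auto simp: ker)
    then have "\<psi> Q = \<zero>\<^bsub>RT\<^esub>"
      using P QR hk \<psi>.hom_closed[OF QR] by (simp add: RY.minus_eq)
    then have "Q = \<zero>\<^bsub>RY\<^esub>"
      using monomial_subst_inj[OF finV c fstV JV _ nzd Q]
      by (auto simp: \<psi>_def RT_def RY mpoly_zero J_def inj_on_def)
    then have "mpoly_const R h [^]\<^bsub>RY\<^esub> k \<otimes>\<^bsub>RY\<^esub> P \<in> L"
      using kL hk P by (simp add: RY.minus_eq mpoly_const_pow[OF hR, of V, folded RY])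
    then show "P \<in> \<Gamma>"
      using P(1) by (auto simp: \<Gamma>_def saturation_def L_def G_def)
  qed
  \<comment> \<open>The multi-Rees algebra inherits its zero from \<open>RT\<close>; only the
    carrier changes, and the kernel depends on the target only through its zero.\<close>
  moreover have "a_kernel RY (multi_Rees R s I) \<phi> = a_kernel RY RT \<psi>"
    if "is_Rees_presentation R s n I f \<phi>" for \<phi>
  proof -
    have "\<phi> P = \<zero>\<^bsub>multi_Rees R s I\<^esub> \<longleftrightarrow> \<psi> P = \<zero>\<^bsub>RT\<^esub>" if "P \<in> carrier RY" for P
      by (simp add: unique[OF \<open>is_Rees_presentation R s n I f \<phi>\<close> that] Rees)
    then show ?thesis
      unfolding a_kernel_def' by blast
  qed
  ultimately show ?thesis
    using pres by auto
qed

end
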